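(* Let $\mathcal F$ be a function space on a finite partially ordered set $\mathfrak T$, with corresponding global function space $\mathcal F(\mathcal T)$. Assume that we have local extension operators $E^{\mathcal T}_F\colon\mathring{\mathcal F}(F)\to\mathcal F(\mathcal T)$ for every $F\in\mathfrak T$, and set $E^T_F:=\operatorname{tr}^{\mathcal T}_TE^{\mathcal T}_F\colon\mathring{\mathcal F}(F)\to\mathcal F(T)$ for $F,T\in\mathfrak T$. Then, for every $T\in\mathfrak T$, $\mathcal F(T)$ is the (internal) direct sum $$\mathcal F(T)=\bigoplus_{F\le T}E_F^T\mathring{\mathcal F}(F).$$
   Context: All vector spaces are over a fixed field. A function space $\mathcal F$ on a partially ordered set $\mathfrak T$ consists of a vector space $\mathcal F(F)$ for every $F\in\mathfrak T$ and a linear map $\operatorname{tr}^F_K\colon\mathcal F(F)\to\mathcal F(K)$ (trace map) for every relation $K\le F$, such that $\operatorname{tr}^F_F$ is the identity and $\operatorname{tr}^G_K\circ\operatorname{tr}^F_G=\operatorname{tr}^F_K$ whenever $K\le G\le F$. The subspace of vanishing trace is $\mathring{\mathcal F}(F)=\{\phi\in\mathcal F(F)\mid\operatorname{tr}^F_K\phi=0\text{ for all }K<F\}$. The global function space is $$\mathcal F(\mathcal T)=\Big\{(\phi_F)_{F\in\mathfrak T}\in\prod_{F\in\mathfrak T}\mathcal F(F)\;\Big|\;\operatorname{tr}^F_K\phi_F=\phi_K\text{ for all }K\le F\Big\}$$ (here $\mathcal T$ is merely a symbol, distinct from elements $T\in\mathfrak T$), with $\operatorname{tr}^{\mathcal T}_F\colon\mathcal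 F(\mathcal T)\to\mathcal F(F)$ the natural projections. For $K\in\mathfrak T$, a local extension operator is a linear map $E^{\mathcal T}_K\colon\mathring{\mathcal F}(K)\to\mathcal F(\mathcal T)$ such that $\operatorname{tr}^{\mathcal T}_KE^{\mathcal T}_K\colon\mathring{\mathcal F}(K)\to\mathcal F(K)$ is the inclusion and $\operatorname{tr}^{\mathcal T}_FE^{\mathcal T}_K=0$ for all $F\in\mathfrak T$ with $K\not\le F$. *)

theory Defs
  imports "Jordan_Normal_Form.Missing_VectorSpace"
begin

text \<open>
  The poset is a set \<open>P\<close> in a type of class \<open>order\<close>, with the induced order. The spaces \<open>V F\<close> may have
  different carriers and operations; that they share the element type \<open>'v\<close> is no restriction, as
  \<open>'v\<close> may be taken to be a disjoint union. The trace map from \<open>V F\<close> to \<open>V K\<close> is \<open>tr F K\<close>; its values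
  are only relevant for \<open>K \<le> F\<close> in \<open>P\<close> and on the carrier of \<open>V F\<close>.
\<close>

locale function_space =
  fixes k :: "('k, 'm) ring_scheme"
    and P :: "'p::order set"
    and V :: "'p \<Rightarrow> ('k, 'v) module"
    and tr :: "'p \<Rightarrow> 'p \<Rightarrow> 'v \<Rightarrow> 'v"
  assumes field: "field k"
    and space: "F \<in> P \<Longrightarrow> vectorspace k (V F)"
    and tr_linear: "\<lbrakk>F \<in> P; K \<in> P; K \<le> F\<rbrakk> \<Longrightarrow> linear_map k (V F) (V K) (tr F K)"
    and tr_id: "\<lbrakk>F \<in> P; \<phi> \<in> carrier (V F)\<rbrakk> \<Longrightarrow> tr F F \<phi> = \<phi>"
    and tr_comp: "\<lbrakk>F \<in> P; G \<in> P; K \<in> P; K \<le> G; G \<le> F; \<phi> \<in> carrier (V F)\<rbrakk>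
      \<Longrightarrow> tr G K (tr F G \<phi>) = tr F K \<phi>"

definition vanishing_trace ::
    "'p::order set \<Rightarrow> ('p \<Rightarrow> ('k, 'v) module) \<Rightarrow> ('p \<Rightarrow> 'p \<Rightarrow> 'v \<Rightarrow> 'v) \<Rightarrow> 'p \<Rightarrow> 'v set"
  where "vanishing_trace P V tr F =
    {\<phi> \<in> carrier (V F). \<forall>K\<in>P. K < F \<longrightarrow> tr F K \<phi> = \<zero>\<^bsub>V K\<^esub>}"

abbreviation vanishing_trace_space ::
    "'p::order set \<Rightarrow> ('p \<Rightarrow> ('k, 'v) module) \<Rightarrow> ('p \<Rightarrow> 'p \<Rightarrow> 'v \<Rightarrow> 'v) \<Rightarrow> 'p \<Rightarrow> ('k, 'v) module"
  where "vanishing_trace_space P V tr F \<equiv> (V F)\<lparr>carrier := vanishing_trace P V tr F\<rparr>"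

text \<open>
  The fields \<open>mult\<close> and \<open>one\<close> only exist because the record type \<open>module\<close> extends \<open>ring\<close>; they play no
  role for vector spaces.
\<close>

definition global_space ::
    "'p::order set \<Rightarrow> ('p \<Rightarrow> ('k, 'v) module) \<Rightarrow> ('p \<Rightarrow> 'p \<Rightarrow> 'v \<Rightarrow> 'v) \<Rightarrow> ('k, 'p \<Rightarrow> 'v) module"
  where "global_space P V tr =
    \<lparr>carrier = {\<phi> \<in> \<Pi>\<^sub>E F\<in>P. carrier (V F). \<forall>F\<in>P. \<forall>K\<in>P. K \<le> F \<longrightarrow> tr F K (\<phi> F) = \<phi> K},
     mult = (\<lambda>\<phi> \<psi>. \<lambda>F\<in>P. \<zero>\<^bsub>V F\<^esub>),
     one = (\<lambda>F\<in>P. \<zero>\<^bsub>V F\<^esub>),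
     zero = (\<lambda>F\<in>P. \<zero>\<^bsub>V F\<^esub>),
     add = (\<lambda>\<phi> \<psi>. \<lambda>F\<in>P. \<phi> F \<oplus>\<^bsub>V F\<^esub> \<psi> F),
     smult = (\<lambda>a \<phi>. \<lambda>F\<in>P. a \<odot>\<^bsub>V F\<^esub> \<phi> F)\<rparr>"

definition global_trace :: "'p \<Rightarrow> ('p \<Rightarrow> 'v) \<Rightarrow> 'v"
  where "global_trace F \<phi> = \<phi> F"

definition local_extension_operator ::
    "('k, 'm) ring_scheme \<Rightarrow> 'p::order set \<Rightarrow> ('p \<Rightarrow> ('k, 'v) module) \<Rightarrow>
     ('p \<Rightarrow> 'p \<Rightarrow> 'v \<Rightarrow> 'v) \<Rightarrow> 'p \<Rightarrow> ('v \<Rightarrow> 'p \<Rightarrow> 'v) \<Rightarrow> bool"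
  where "local_extension_operator k P V tr K E \<longleftrightarrow>
    linear_map k (vanishing_trace_space P V tr K) (global_space P V tr) E \<and>
    (\<forall>\<phi>\<in>vanishing_trace P V tr K. global_trace K (E \<phi>) = \<phi>) \<and>
    (\<forall>F\<in>P. \<not> K \<le> F \<longrightarrow> (\<forall>\<phi>\<in>vanishing_trace P V tr K. global_trace F (E \<phi>) = \<zero>\<^bsub>V F\<^esub>))"

definition extension_operator :: "('p \<Rightarrow> 'v \<Rightarrow> 'p \<Rightarrow> 'v) \<Rightarrow> 'p \<Rightarrow> 'p \<Rightarrow> 'v \<Rightarrow> 'v"
  where "extension_operator E F T \<phi> = global_trace T (E F \<phi>)"

text \<open>
  Internal direct sum of a finite family of subspaces: every vector is a sum of a unique family of
  components.
\<close>

definition internal_direct_sum ::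
    "('k, 'm) ring_scheme \<Rightarrow> ('k, 'v, 'n) module_scheme \<Rightarrow> 'i set \<Rightarrow> ('i \<Rightarrow> 'v set) \<Rightarrow> bool"
  where "internal_direct_sum k V I W \<longleftrightarrow>
    finite I \<and> (\<forall>i\<in>I. subspace k (W i) V) \<and>
    (\<forall>v\<in>carrier V. \<exists>!w. w \<in> (\<Pi>\<^sub>E i\<in>I. W i) \<and> v = (\<Oplus>\<^bsub>V\<^esub>i\<in>I. w i))"

text \<open>
  The locale \<^locale>\<open>linear_map\<close> requires its domain and codomain to be vector spaces. The following
  facts show that this adds nothing to the definition of a local extension operator.
\<close>

context function_space
begin

lemma vanishing_trace_subspace:
  assumes F: "F \<in> P"
  shows "subspace k (vanishing_trace P V tr F) (V F)"
proof -
  interpret F: vectorspace k "V F" by (rule space[OF F])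
  have lin: "linear_map k (V F) (V K) (tr F K)" if "K \<in> P" "K < F" for K
    using that F by (intro tr_linear) auto
  show ?thesis
  proof (intro subspace.intro submodule.intro)
    fix v w assume vw: "v \<in> vanishing_trace P V tr F" "w \<in> vanishing_trace P V tr F"
    have "tr F K (v \<oplus>\<^bsub>V F\<^esub> w) = \<zero>\<^bsub>V K\<^esub>" if K: "K \<in> P" "K < F" for K
    proof -
      interpret l: linear_map k "V F" "V K" "tr F K" by (rule lin[OF K])
      show ?thesis using vw K by (simp add: vanishing_trace_def)
    qed
    then show "v \<oplus>\<^bsub>V F\<^esub> w \<in> vanishing_trace P V tr F"
      using vw by (simp add: vanishing_trace_def)
  next
    have "tr F K \<zero>\<^bsub>V F\<^esub> = \<zero>\<^bsub>V K\<^esub>" if K: "K \<in> P" "K < F" for K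
    proof -
      interpret l: linear_map k "V F" "V K" "tr F K" by (rule lin[OF K])
      show ?thesis by simp
    qed
    then show "\<zero>\<^bsub>V F\<^esub> \<in> vanishing_trace P V tr F"
      by (simp add: vanishing_trace_def)
  next
    fix c v assume cv: "c \<in> carrier k" "v \<in> vanishing_trace P V tr F"
    have "tr F K (c \<odot>\<^bsub>V F\<^esub> v) = \<zero>\<^bsub>V K\<^esub>" if K: "K \<in> P" "K < F" for K
    proof -
      interpret l: linear_map k "V F" "V K" "tr F K" by (rule lin[OF K])
      show ?thesis using cv K by (simp add: vanishing_trace_def)
    qed
    then show "c \<odot>\<^bsub>V F\<^esub> v \<in> vanishing_trace P V tr F"
      using cv by (simp add: vanishing_trace_def)
  qed (use F.vectorspace_axioms F.module_axioms in \<open>auto simp: vanishing_trace_def\<close>)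
qed

lemma vanishing_trace_vectorspace:
  assumes F: "F \<in> P"
  shows "vectorspace k (vanishing_trace_space P V tr F)"
  using vectorspace.subspace_is_vs[OF space[OF F] vanishing_trace_subspace[OF F]] .

lemma global_space_vectorspace: "vectorspace k (global_space P V tr)"
proof -
  let ?G = "global_space P V tr"
  interpret k: field k by (rule field)
  have M: "module k (V F)" if "F \<in> P" for F
    using space[OF that] by (simp add: vectorspace_def)
  have A: "abelian_group (V F)" if "F \<in> P" for F
    using M[OF that] by (simp add: module_def)
  have mem: "\<phi> F \<in> carrier (V F)" if "\<phi> \<in> carrier ?G" "F \<in> P" for \<phi> F
    using that by (auto simp: global_space_def)
  have ext: "\<phi> = \<psi>" if "\<phi> \<in> carrier ?G" "\<psi> \<in> carrier ?G" "\<And>F. F \<in> P \<Longrightarrow> \<phi> F = \<psi> F" for \<phi> \<psi>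
    using that by (intro PiE_ext[of _ P]) (auto simp: global_space_def)
  have app: "(\<phi> \<oplus>\<^bsub>?G\<^esub> \<psi>) F = \<phi> F \<oplus>\<^bsub>V F\<^esub> \<psi> F" "(a \<odot>\<^bsub>?G\<^esub> \<phi>) F = a \<odot>\<^bsub>V F\<^esub> \<phi> F" "\<zero>\<^bsub>?G\<^esub> F = \<zero>\<^bsub>V F\<^esub>"
    if "F \<in> P" for \<phi> \<psi> a F
    using that by (simp_all add: global_space_def)
  have assoc: "x \<oplus>\<^bsub>V F\<^esub> y \<oplus>\<^bsub>V F\<^esub> z = x \<oplus>\<^bsub>V F\<^esub> (y \<oplus>\<^bsub>V F\<^esub> z)"
    if "F \<in> P" "x \<in> carrier (V F)" "y \<in> carrier (V F)" "z \<in> carrier (V F)" for F x y z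
    using abelian_groupE(3)[OF A[OF that(1)]] that by auto
  have comm: "x \<oplus>\<^bsub>V F\<^esub> y = y \<oplus>\<^bsub>V F\<^esub> x" if "F \<in> P" "x \<in> carrier (V F)" "y \<in> carrier (V F)" for F x y
    using abelian_groupE(4)[OF A[OF that(1)]] that by auto
  have l_zero: "\<zero>\<^bsub>V F\<^esub> \<oplus>\<^bsub>V F\<^esub> x = x" if "F \<in> P" "x \<in> carrier (V F)" for F x
    using abelian_groupE(5)[OF A[OF that(1)]] that by auto
  have add: "\<phi> \<oplus>\<^bsub>?G\<^esub> \<psi> \<in> carrier ?G" if pq: "\<phi> \<in> carrier ?G" "\<psi> \<in> carrier ?G" for \<phi> \<psi>
  proof -
    have "tr F K (\<phi> F \<oplus>\<^bsub>V F\<^esub> \<psi> F) = \<phi> K \<oplus>\<^bsub>V K\<^esub> \<psi> K" if FK: "F \<in> P" "K \<in> P" "K \<le> F" for F K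
    proof -
      interpret l: linear_map k "V F" "V K" "tr F K" by (rule tr_linear[OF FK])
      show ?thesis using pq FK mem[OF pq(1) FK(1)] mem[OF pq(2) FK(1)]
        by (simp add: global_space_def)
    qed
    moreover have "\<phi> F \<oplus>\<^bsub>V F\<^esub> \<psi> F \<in> carrier (V F)" if "F \<in> P" for F
      using abelian_groupE(1)[OF A[OF that]] mem pq that by blast
    ultimately show ?thesis by (simp add: global_space_def)
  qed
  have smult: "a \<odot>\<^bsub>?G\<^esub> \<phi> \<in> carrier ?G" if pq: "a \<in> carrier k" "\<phi> \<in> carrier ?G" for a \<phi>
  proof -
    have "tr F K (a \<odot>\<^bsub>V F\<^esub> \<phi> F) = a \<odot>\<^bsub>V K\<^esub> \<phi> K" if FK: "F \<in> P" "K \<in> P" "K \<le> F" for F K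
    proof -
      interpret l: linear_map k "V F" "V K" "tr F K" by (rule tr_linear[OF FK])
      show ?thesis using pq FK mem[OF pq(2) FK(1)] by (simp add: global_space_def)
    qed
    moreover have "a \<odot>\<^bsub>V F\<^esub> \<phi> F \<in> carrier (V F)" if "F \<in> P" for F
      using module.smult_closed[OF M[OF that]] mem pq that by blast
    ultimately show ?thesis by (simp add: global_space_def)
  qed
  have zero: "\<zero>\<^bsub>?G\<^esub> \<in> carrier ?G"
  proof -
    have "tr F K \<zero>\<^bsub>V F\<^esub> = \<zero>\<^bsub>V K\<^esub>" if FK: "F \<in> P" "K \<in> P" "K \<le> F" for F K
    proof -
      interpret l: linear_map k "V F" "V K" "tr F K" by (rule tr_linear[OF FK])
      show ?thesis by simp
    qed
    then show ?thesis using abelian_groupE(2)[OF A] by (simp add: global_space_def)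
  qed
  have "module k ?G"
  proof (rule moduleI)
    show "abelian_group ?G"
    proof (rule abelian_groupI)
      fix \<phi> assume p: "\<phi> \<in> carrier ?G"
      have "(\<ominus>\<^bsub>k\<^esub> \<one>\<^bsub>k\<^esub>) \<odot>\<^bsub>?G\<^esub> \<phi> \<oplus>\<^bsub>?G\<^esub> \<phi> = \<zero>\<^bsub>?G\<^esub>"
      proof (rule ext)
        fix F assume F: "F \<in> P"
        interpret v: module k "V F" by (rule M[OF F])
        show "((\<ominus>\<^bsub>k\<^esub> \<one>\<^bsub>k\<^esub>) \<odot>\<^bsub>?G\<^esub> \<phi> \<oplus>\<^bsub>?G\<^esub> \<phi>) F = \<zero>\<^bsub>?G\<^esub> F"
          using mem[OF p F] by (simp add: app F v.smult_l_minus v.M.l_neg)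
      qed (auto intro!: add smult zero p)
      then show "\<exists>\<psi>\<in>carrier ?G. \<psi> \<oplus>\<^bsub>?G\<^esub> \<phi> = \<zero>\<^bsub>?G\<^esub>"
        using smult[OF _ p] by blast
    qed (auto intro!: ext add zero simp: app assoc l_zero mem comm)
  qed (auto intro!: ext add smult zero k.is_cring simp: app mem
      module.smult_l_distr[OF M] module.smult_r_distr[OF M]
      module.smult_assoc1[OF M] module.smult_one[OF M])
  then show ?thesis by (simp add: vectorspace_def field)
qed

end

end

theory Submission
  imports Defs
begin

text \<open>
  A compatible family \<open>x\<close> of vectors, one for each member of a finite lower set \<open>D\<close> of the poset, is
  the same thing as a family of trace-free components \<open>\<phi> F\<close>, \<open>F \<in> D\<close>, the former being the sum of
  the extensions of the latter. The extensions form a triangular system: at \<open>K\<close>, only the components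
  \<open>\<phi> F\<close> with \<open>F \<le> K\<close> contribute, and \<open>\<phi> K\<close> contributes itself. So \<open>\<phi> K\<close> must be \<open>x K\<close> minus the
  contributions of the \<open>F < K\<close>. This determines the components one after the other
  (\<open>extension_sum_inject\<close>). Conversely, the vector computed in this way has vanishing trace, since its
  trace on a smaller \<open>K'\<close> is \<open>x K'\<close> minus a sum that is already known to equal \<open>x K'\<close>
  (\<open>compatible_family_is_extension_sum\<close>).

  The decomposition of \<open>V T\<close> is the case where \<open>D\<close> consists of all elements below \<open>T\<close>: this set has
  the greatest element \<open>T\<close>, so that a compatible family on it is just a vector of \<open>V T\<close> with all its
  traces.
\<close>

lemma (in linear_map) linear_map_finsum:
  assumes "finite A" and "\<And>a. a \<in> A \<Longrightarrow> g a \<in> carrier V"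
  shows "T (\<Oplus>\<^bsub>V\<^esub>a\<in>A. g a) = (\<Oplus>\<^bsub>W\<^esub>a\<in>A. T (g a))"
  using assms by (induction A rule: finite_induct) (auto simp: Pi_def)

locale function_space_with_extensions = function_space k P V tr
  for k :: "('k, 'm) ring_scheme"
    and P :: "'p::order set"
    and V :: "'p \<Rightarrow> ('k, 'v) module"
    and tr :: "'p \<Rightarrow> 'p \<Rightarrow> 'v \<Rightarrow> 'v" +
  fixes E :: "'p \<Rightarrow> 'v \<Rightarrow> 'p \<Rightarrow> 'v"
  assumes finite_poset: "finite P"
    and extension: "F \<in> P \<Longrightarrow> local_extension_operator k P V tr F (E F)"
begin

abbreviation trace_free :: "'p \<Rightarrow> 'v set"
  where "trace_free \<equiv> vanishing_trace P V tr"

abbreviation ext :: "'p \<Rightarrow> 'p \<Rightarrow> 'v \<Rightarrow> 'v"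
  where "ext \<equiv> extension_operator E"

definition extension_sum :: "'p set \<Rightarrow> ('p \<Rightarrow> 'v) \<Rightarrow> 'p \<Rightarrow> 'v"
  where "extension_sum D \<phi> K = (\<Oplus>\<^bsub>V K\<^esub>F\<in>D. ext F K (\<phi> F))"

lemma abelian_group_space: "F \<in> P \<Longrightarrow> abelian_group (V F)"
  using space by (simp add: vectorspace_def module_def)

lemma trace_free_closed: "\<phi> \<in> trace_free F \<Longrightarrow> \<phi> \<in> carrier (V F)"
  by (simp add: vanishing_trace_def)

lemma ext_global:
  assumes "F \<in> P" "\<phi> \<in> trace_free F"
  shows "E F \<phi> \<in> carrier (global_space P V tr)"
proof -
  interpret linear_map k "vanishing_trace_space P V tr F" "global_space P V tr" "E F"
    using extension[OF assms(1)] by (simp add: local_extension_operator_def)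
  show ?thesis using f_im assms(2) by auto
qed

lemma ext_closed:
  assumes "F \<in> P" "K \<in> P" "\<phi> \<in> trace_free F"
  shows "ext F K \<phi> \<in> carrier (V K)"
  using ext_global[OF assms(1,3)] assms(2)
  by (auto simp: extension_operator_def global_trace_def global_space_def)

lemma tr_ext:
  assumes "F \<in> P" "G \<in> P" "K \<in> P" "K \<le> G" "\<phi> \<in> trace_free F"
  shows "tr G K (ext F G \<phi>) = ext F K \<phi>"
  using ext_global[OF assms(1,5)] assms(2-4)
  by (auto simp: extension_operator_def global_trace_def global_space_def)

lemma ext_self: "\<lbrakk>F \<in> P; \<phi> \<in> trace_free F\<rbrakk> \<Longrightarrow> ext F F \<phi> = \<phi>"
  using extension by (simp add: local_extension_operator_def extension_operator_def)

lemma ext_eq_zero: "\<lbrakk>F \<in> P; K \<in> P; \<not> F \<le> K; \<phi> \<in> trace_free F\<rbrakk> \<Longrightarrow> ext F K \<phi> = \<zero>\<^bsub>V K\<^esub>"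
  using extension by (simp add: local_extension_operator_def extension_operator_def)

lemma ext_linear:
  assumes F: "F \<in> P" and K: "K \<in> P"
  shows "linear_map k (vanishing_trace_space P V tr F) (V K) (ext F K)"
proof -
  interpret l: linear_map k "vanishing_trace_space P V tr F" "global_space P V tr" "E F"
    using extension[OF F] by (simp add: local_extension_operator_def)
  have "ext F K (\<phi> \<oplus>\<^bsub>V F\<^esub> \<psi>) = ext F K \<phi> \<oplus>\<^bsub>V K\<^esub> ext F K \<psi>"
    if "\<phi> \<in> trace_free F" "\<psi> \<in> trace_free F" for \<phi> \<psi>
    using l.f_add[of \<phi> \<psi>] that K
    by (simp add: extension_operator_def global_trace_def global_space_def)
  moreover have "ext F K (a \<odot>\<^bsub>V F\<^esub> \<phi>) = a \<odot>\<^bsub>V K\<^esub> ext F K \<phi>"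
    if "a \<in> carrier k" "\<phi> \<in> trace_free F" for a \<phi>
    using l.f_smult[of a \<phi>] that K
    by (simp add: extension_operator_def global_trace_def global_space_def)
  ultimately show ?thesis
    using space[OF K] vanishing_trace_vectorspace[OF F] ext_closed[OF F K]
    by (auto simp: linear_map_def mod_hom_def mod_hom_axioms_def module_hom_def vectorspace_def)
qed

lemma extension_sum_closed:
  assumes "D \<subseteq> P" "K \<in> P" "\<And>F. F \<in> D \<Longrightarrow> \<phi> F \<in> trace_free F"
  shows "extension_sum D \<phi> K \<in> carrier (V K)"
proof -
  interpret abelian_group "V K" by (rule abelian_group_space[OF assms(2)])
  show ?thesis
    unfolding extension_sum_def using assms by (auto intro!: finsum_closed ext_closed)
qed

lemma tr_extension_sum:
  assumes D: "D \<subseteq> P" and GK: "G \<in> P" "K \<in> P" "K \<le> G"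
    and \<phi>: "\<And>F. F \<in> D \<Longrightarrow> \<phi> F \<in> trace_free F"
  shows "tr G K (extension_sum D \<phi> G) = extension_sum D \<phi> K"
proof -
  interpret linear_map k "V G" "V K" "tr G K" by (rule tr_linear[OF GK])
  have "tr G K (extension_sum D \<phi> G) = (\<Oplus>\<^bsub>V K\<^esub>F\<in>D. tr G K (ext F G (\<phi> F)))"
    unfolding extension_sum_def
    using D GK \<phi> finite_subset[OF D finite_poset]
    by (intro linear_map_finsum) (auto intro: ext_closed)
  also have "\<dots> = extension_sum D \<phi> K"
    unfolding extension_sum_def
    using D GK \<phi>
    by (intro abelian_monoid.finsum_cong'[OF
          abelian_group.axioms(1)[OF abelian_group_space[OF GK(2)]]])
      (auto intro!: tr_ext ext_closed)
  finally show ?thesis .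
qed

lemma extension_sum_remove:
  assumes D: "D \<subseteq> P" and M: "M \<in> D" and K: "K \<in> P"
    and \<phi>: "\<And>F. F \<in> D \<Longrightarrow> \<phi> F \<in> trace_free F"
  shows "extension_sum D \<phi> K = ext M K (\<phi> M) \<oplus>\<^bsub>V K\<^esub> extension_sum (D - {M}) \<phi> K"
proof -
  interpret abelian_group "V K" by (rule abelian_group_space[OF K])
  have "extension_sum (insert M (D - {M})) \<phi> K
      = ext M K (\<phi> M) \<oplus>\<^bsub>V K\<^esub> extension_sum (D - {M}) \<phi> K"
    unfolding extension_sum_def
    using D M K \<phi> finite_subset[OF D finite_poset]
    by (intro finsum_insert) (auto intro!: ext_closed)
  then show ?thesis using M by (simp add: insert_absorb)
qed

text \<open>
  At a minimal \<open>K\<close> where \<open>\<phi>\<close> and \<open>\<psi>\<close> differ, all other summands agree: for \<open>F < K\<close> by minimality,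
  for \<open>\<not> F \<le> K\<close> because they vanish. Cancelling them leaves \<open>\<phi> K = \<psi> K\<close>.
\<close>

lemma extension_sum_inject:
  assumes D: "D \<subseteq> P"
    and \<phi>: "\<And>F. F \<in> D \<Longrightarrow> \<phi> F \<in> trace_free F"
    and \<psi>: "\<And>F. F \<in> D \<Longrightarrow> \<psi> F \<in> trace_free F"
    and eq: "\<And>K. K \<in> D \<Longrightarrow> extension_sum D \<phi> K = extension_sum D \<psi> K"
    and F: "F \<in> D"
  shows "\<phi> F = \<psi> F"
proof (rule ccontr)
  let ?N = "{F \<in> D. \<phi> F \<noteq> \<psi> F}"
  assume "\<phi> F \<noteq> \<psi> F"
  then have "?N \<noteq> {}" using F by auto
  moreover have "finite ?N" using finite_subset[OF D finite_poset] by auto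
  ultimately obtain K where K: "K \<in> D" "\<phi> K \<noteq> \<psi> K"
    and min: "\<And>G. \<lbrakk>G \<in> D; \<phi> G \<noteq> \<psi> G; G \<le> K\<rbrakk> \<Longrightarrow> K = G"
    using finite_has_minimal[of ?N] by blast
  have KP: "K \<in> P" using K D by auto
  interpret abelian_group "V K" by (rule abelian_group_space[OF KP])
  have "ext G K (\<phi> G) = ext G K (\<psi> G)" if "G \<in> D - {K}" for G
  proof (cases "G \<le> K")
    case True
    have "\<phi> G = \<psi> G" using min[of G] True that by blast
    then show ?thesis by simp
  next
    case False
    then show ?thesis using that D KP \<phi> \<psi> by (auto simp: ext_eq_zero)
  qed
  then have rest: "extension_sum (D - {K}) \<phi> K = extension_sum (D - {K}) \<psi> K"
    unfolding extension_sum_def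
    using D KP \<psi> by (intro finsum_cong') (auto intro!: ext_closed)
  have "\<phi> K \<oplus>\<^bsub>V K\<^esub> extension_sum (D - {K}) \<psi> K = \<psi> K \<oplus>\<^bsub>V K\<^esub> extension_sum (D - {K}) \<psi> K"
    using eq[OF K(1)] extension_sum_remove[OF D K(1) KP, of \<phi>]
      extension_sum_remove[OF D K(1) KP, of \<psi>] \<phi> \<psi> K(1) KP rest
    by (simp add: ext_self)
  moreover have "extension_sum (D - {K}) \<psi> K \<in> carrier (V K)"
    using D KP \<psi> by (intro extension_sum_closed) auto
  ultimately have "\<phi> K = \<psi> K"
    using \<phi>[OF K(1)] \<psi>[OF K(1)] by (simp add: trace_free_closed)
  with K(2) show False by simp
qed

text \<open>
  The induction removes a maximal element \<open>M\<close> from the lower set \<open>D\<close>. The component at \<open>M\<close> is the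
  error that the sum over \<open>D - {M}\<close> makes at \<open>M\<close>. It is trace-free because that sum makes no error
  below \<open>M\<close>, and adding its extension changes nothing on \<open>D - {M}\<close> because \<open>M\<close> is maximal.
\<close>

lemma compatible_family_is_extension_sum:
  assumes "D \<subseteq> P"
    and "\<And>F K. \<lbrakk>F \<in> D; K \<in> P; K \<le> F\<rbrakk> \<Longrightarrow> K \<in> D"
    and "\<And>F. F \<in> D \<Longrightarrow> x F \<in> carrier (V F)"
    and "\<And>F K. \<lbrakk>F \<in> D; K \<in> D; K \<le> F\<rbrakk> \<Longrightarrow> tr F K (x F) = x K"
  shows "\<exists>\<phi>. (\<forall>F\<in>D. \<phi> F \<in> trace_free F) \<and> (\<forall>K\<in>D. extension_sum D \<phi> K = x K)"
proof -
  have "finite D" using assms(1) finite_poset by (rule finite_subset)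
  then show ?thesis using assms
  proof (induction D rule: finite_psubset_induct)
    case (psubset D)
    note D = psubset.prems(1) and lower = psubset.prems(2)
      and x = psubset.prems(3) and compat = psubset.prems(4)
    show ?case
    proof (cases "D = {}")
      case False
      then obtain M where M: "M \<in> D" and max: "\<And>G. \<lbrakk>G \<in> D; M \<le> G\<rbrakk> \<Longrightarrow> M = G"
        using finite_has_maximal[OF psubset.hyps] by blast
      have MP: "M \<in> P" using M D by auto
      let ?D = "D - {M}"
      have "\<exists>\<phi>. (\<forall>F\<in>?D. \<phi> F \<in> trace_free F) \<and> (\<forall>K\<in>?D. extension_sum ?D \<phi> K = x K)"
      proof (rule psubset.IH)
        show "K \<in> ?D" if "F \<in> ?D" "K \<in> P" "K \<le> F" for F K
          using lower[of F K] max[of F] that by auto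
      qed (use M D x compat in auto)
      then obtain \<phi> where \<phi>: "\<And>F. F \<in> ?D \<Longrightarrow> \<phi> F \<in> trace_free F"
        and sum: "\<And>K. K \<in> ?D \<Longrightarrow> extension_sum ?D \<phi> K = x K"
        by blast
      have DP: "?D \<subseteq> P" using D by auto
      interpret M: abelian_group "V M" by (rule abelian_group_space[OF MP])
      have sumM: "extension_sum ?D \<phi> M \<in> carrier (V M)"
        by (rule extension_sum_closed[OF DP MP \<phi>])
      define \<epsilon> where "\<epsilon> = x M \<ominus>\<^bsub>V M\<^esub> extension_sum ?D \<phi> M"
      have "tr M K \<epsilon> = \<zero>\<^bsub>V K\<^esub>" if K: "K \<in> P" "K < M" for K
      proof -
        have le: "K \<le> M" using K by simp
        have KD: "K \<in> ?D" using lower[OF M K(1) le] K by auto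
        interpret linear_map k "V M" "V K" "tr M K" by (rule tr_linear[OF MP K(1) le])
        have "tr M K \<epsilon> = x K \<ominus>\<^bsub>V K\<^esub> extension_sum ?D \<phi> K"
          unfolding \<epsilon>_def using x[OF M] sumM compat[OF M _ le] KD
            tr_extension_sum[OF DP MP K(1) le \<phi>] by simp
        then show ?thesis
          using sum[OF KD] x[of K] KD abelian_group.r_neg[OF abelian_group_space[OF K(1)]]
          by (simp add: a_minus_def)
      qed
      then have \<epsilon>: "\<epsilon> \<in> trace_free M"
        unfolding vanishing_trace_def using x[OF M] sumM by (simp add: \<epsilon>_def)
      let ?\<psi> = "\<phi>(M := \<epsilon>)"
      have \<psi>: "?\<psi> F \<in> trace_free F" if "F \<in> D" for F
        using that \<phi> \<epsilon> by auto
      have split: "extension_sum D ?\<psi> K = ext M K \<epsilon> \<oplus>\<^bsub>V K\<^esub> extension_sum ?D \<phi> K"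
        if K: "K \<in> P" for K
      proof -
        interpret abelian_group "V K" by (rule abelian_group_space[OF K])
        have "extension_sum ?D ?\<psi> K = extension_sum ?D \<phi> K"
          unfolding extension_sum_def
          using DP K \<phi> by (intro finsum_cong') (auto intro!: ext_closed)
        then show ?thesis using extension_sum_remove[OF D M K, of ?\<psi>] \<psi> by simp
      qed
      have "extension_sum D ?\<psi> K = x K" if K: "K \<in> D" for K
      proof (cases "K = M")
        case True
        have "\<epsilon> \<oplus>\<^bsub>V M\<^esub> extension_sum ?D \<phi> M = x M"
          using x[OF M] sumM by (simp add: \<epsilon>_def a_minus_def M.a_assoc M.l_neg)
        then show ?thesis using True split[OF MP] ext_self[OF MP \<epsilon>] by simp
      next
        case False
        have KP: "K \<in> P" using K D by auto
        interpret abelian_group "V K" by (rule abelian_group_space[OF KP])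
        have "\<not> M \<le> K" using max[OF K] False by auto
        then have "ext M K \<epsilon> = \<zero>\<^bsub>V K\<^esub>" using MP KP \<epsilon> by (intro ext_eq_zero)
        then show ?thesis using split[OF KP] sum[of K] x[OF K] K False by simp
      qed
      then show ?thesis using \<psi> by blast
    qed simp
  qed
qed

lemma ext_images_direct_sum:
  assumes T: "T \<in> P"
  shows "internal_direct_sum k (V T) {F \<in> P. F \<le> T} (\<lambda>F. ext F T ` trace_free F)"
    (is "internal_direct_sum k (V T) ?D ?W")
proof -
  interpret abelian_group "V T" by (rule abelian_group_space[OF T])
  have DP: "?D \<subseteq> P" by auto
  have "subspace k (?W F) (V T)" if "F \<in> ?D" for F
  proof -
    interpret linear_map k "vanishing_trace_space P V tr F" "V T" "ext F T"
      using ext_linear that T by auto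
    show ?thesis using imT_is_subspace by (simp add: im_def)
  qed
  moreover have "\<exists>!w. w \<in> (\<Pi>\<^sub>E F\<in>?D. ?W F) \<and> v = (\<Oplus>\<^bsub>V T\<^esub>F\<in>?D. w F)"
    if v: "v \<in> carrier (V T)" for v
  proof -
    have vF: "tr T F v \<in> carrier (V F)" if "F \<in> ?D" for F
    proof -
      interpret linear_map k "V T" "V F" "tr T F" using tr_linear T that by auto
      show ?thesis using v by simp
    qed
    have "\<exists>\<phi>. (\<forall>F\<in>?D. \<phi> F \<in> trace_free F) \<and> (\<forall>K\<in>?D. extension_sum ?D \<phi> K = tr T K v)"
      using T v vF by (intro compatible_family_is_extension_sum) (auto intro: tr_comp)
    then obtain \<phi> where \<phi>: "\<And>F. F \<in> ?D \<Longrightarrow> \<phi> F \<in> trace_free F"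
      and sum: "\<And>K. K \<in> ?D \<Longrightarrow> extension_sum ?D \<phi> K = tr T K v"
      by blast
    let ?w = "\<lambda>F\<in>?D. ext F T (\<phi> F)"
    show ?thesis
    proof (rule ex1I[of _ ?w])
      have "(\<Oplus>\<^bsub>V T\<^esub>F\<in>?D. ?w F) = extension_sum ?D \<phi> T"
        unfolding extension_sum_def
        using \<phi> T by (intro finsum_cong') (auto intro!: ext_closed)
      then have "v = (\<Oplus>\<^bsub>V T\<^esub>F\<in>?D. ?w F)"
        using sum[of T] T v by (simp add: tr_id)
      then show "?w \<in> (\<Pi>\<^sub>E F\<in>?D. ?W F) \<and> v = (\<Oplus>\<^bsub>V T\<^esub>F\<in>?D. ?w F)"
        using \<phi> by auto
    next
      fix w assume w: "w \<in> (\<Pi>\<^sub>E F\<in>?D. ?W F) \<and> v = (\<Oplus>\<^bsub>V T\<^esub>F\<in>?D. w F)"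
      then have "\<forall>F\<in>?D. \<exists>\<psi>. \<psi> \<in> trace_free F \<and> w F = ext F T \<psi>"
        by blast
      then obtain \<psi> where \<psi>: "\<And>F. F \<in> ?D \<Longrightarrow> \<psi> F \<in> trace_free F"
        and w\<psi>: "\<And>F. F \<in> ?D \<Longrightarrow> w F = ext F T (\<psi> F)"
        by metis
      have "(\<Oplus>\<^bsub>V T\<^esub>F\<in>?D. w F) = extension_sum ?D \<psi> T"
        unfolding extension_sum_def
        using \<psi> w\<psi> T by (intro finsum_cong') (auto intro!: ext_closed)
      then have v\<psi>: "v = extension_sum ?D \<psi> T" using w by simp
      \<comment> \<open>The sums agree at \<open>T\<close>, hence, by applying the traces, at every \<open>K \<le> T\<close>.\<close>
      have "extension_sum ?D \<phi> K = extension_sum ?D \<psi> K" if "K \<in> ?D" for K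
        using sum[OF that] tr_extension_sum[OF DP T _ _ \<psi>, of K] that v\<psi> by simp
      then have "\<phi> F = \<psi> F" if "F \<in> ?D" for F
        using extension_sum_inject[OF DP \<phi> \<psi> _ that] by blast
      then show "w = ?w"
        using w w\<psi> by (intro PiE_ext[of w ?D ?W]) (auto intro: \<phi>)
    qed
  qed
  ultimately show ?thesis
    unfolding internal_direct_sum_def using finite_poset by simp
qed

end

theorem corollary2p15:
  fixes k :: "('k, 'm) ring_scheme"
    and P :: "'p::order set"
    and V :: "'p \<Rightarrow> ('k, 'v) module"
    and tr :: "'p \<Rightarrow> 'p \<Rightarrow> 'v \<Rightarrow> 'v"
    and E :: "'p \<Rightarrow> 'v \<Rightarrow> 'p \<Rightarrow> 'v"
  assumes "finite P"
    and "function_space k P V tr"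
    and "\<And>F. F \<in> P \<Longrightarrow> local_extension_operator k P V tr F (E F)"
    and "T \<in> P"
  shows "internal_direct_sum k (V T) {F \<in> P. F \<le> T}
    (\<lambda>F. extension_operator E F T ` vanishing_trace P V tr F)"
proof -
  interpret function_space_with_extensions k P V tr E
    using assms(1-3)
    by (intro function_space_with_extensions.intro function_space_with_extensions_axioms.intro)
  show ?thesis by (rule ext_images_direct_sum[OF assms(4)])
qed

end
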